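(* In a space of incidence, the following two statements are equivalent. (Gallucci's axiom) If $a,b,c$ are three pairwise skew lines and $e,f,g$ are three pairwise skew lines such that each of $a,b,c$ meets each of $e,f,g$, then every line $h$ that meets all of $a,b,c$ and every line $d$ that meets all of $e,f,g$ meet each other. (Pappus's theorem) In every plane of the space: if $l\neq l'$ are two lines of the plane, $A,B,C$ are three distinct points of $l$ and $A',B',C'$ are three distinct points of $l'$, none of these six points being the point $l\cap l'$, then the points $AB'\cap A'B$, $AC'\cap A'C$ and $BC'\cap B'C$ are collinear.
   Context: A space of incidence consists of points, lines and planes with an incidence relation; a line is called incident with a plane if all points of the line are incident with the plane. Points are collinear (coplanar) if they are all incident with one line (one plane). The following axioms hold ("two", "three", etc. mean distinct elements): (S1) Two points uniquely determine a line which is incident with them. (S2) Two planes uniquely determine a line which is incident with them (their line of intersection). (S3) Three non-collinear points uniquely determine a plane incident with them. (S4) Three planes which have no common line uniquely determine a point incident with them. (S5) If two points incident with a line are incident with a plane, then all points of this line are incident with this plane. (S6) If two planes incident with a line are incident with a point, then all planes incident with this line are incident with this point. (S7) In every plane there exist four points, no three of which are collinear. (S8) There exist five points, no four of which are coplanar. Two lines are skew if they do not lie in a common plane. Two lines meet if they have a common point. $PQ$ denotes the line through distinct points $P,Q$, and $l\cap m$ denotes the common point of two distinct coplanar lines. *)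

theory Defs
  imports Main
begin

(* Points, lines and planes are the elements of three types; there is no
   primitive incidence between lines and planes. *)
locale incidence_structure =
  fixes on_line :: "'p \<Rightarrow> 'l \<Rightarrow> bool"
    and on_plane :: "'p \<Rightarrow> 'q \<Rightarrow> bool"
begin

definition line_on_plane :: "'l \<Rightarrow> 'q \<Rightarrow> bool" where
  "line_on_plane l \<pi> \<longleftrightarrow> (\<forall>P. on_line P l \<longrightarrow> on_plane P \<pi>)"

definition collinear :: "'p set \<Rightarrow> bool" where
  "collinear S \<longleftrightarrow> (\<exists>l. \<forall>P\<in>S. on_line P l)"

definition coplanar :: "'p set \<Rightarrow> bool" where
  "coplanar S \<longleftrightarrow> (\<exists>\<pi>. \<forall>P\<in>S. on_plane P \<pi>)"

definition skew :: "'l \<Rightarrow> 'l \<Rightarrow> bool" where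
  "skew l m \<longleftrightarrow> l \<noteq> m \<and> \<not> (\<exists>\<pi>. line_on_plane l \<pi> \<and> line_on_plane m \<pi>)"

definition meets :: "'l \<Rightarrow> 'l \<Rightarrow> bool" where
  "meets l m \<longleftrightarrow> (\<exists>P. on_line P l \<and> on_line P m)"

(* Meaningful only for distinct points. *)
definition line_through :: "'p \<Rightarrow> 'p \<Rightarrow> 'l" where
  "line_through P Q = (THE l. on_line P l \<and> on_line Q l)"

(* Meaningful only for distinct coplanar lines. *)
definition common_point :: "'l \<Rightarrow> 'l \<Rightarrow> 'p" where
  "common_point l m = (THE P. on_line P l \<and> on_line P m)"

definition gallucci_axiom :: bool where
  "gallucci_axiom \<longleftrightarrow>
    (\<forall>a b c e f g.
      skew a b \<and> skew a c \<and> skew b c \<and>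
      skew e f \<and> skew e g \<and> skew f g \<and>
      (\<forall>x\<in>{a, b, c}. \<forall>y\<in>{e, f, g}. meets x y) \<longrightarrow>
      (\<forall>h d. (\<forall>x\<in>{a, b, c}. meets h x) \<and> (\<forall>y\<in>{e, f, g}. meets d y) \<longrightarrow> meets h d))"

definition pappus_theorem :: bool where
  "pappus_theorem \<longleftrightarrow>
    (\<forall>\<pi> l l' A B C A' B' C'.
      line_on_plane l \<pi> \<and> line_on_plane l' \<pi> \<and> l \<noteq> l' \<and>
      on_line A l \<and> on_line B l \<and> on_line C l \<and> distinct [A, B, C] \<and>
      on_line A' l' \<and> on_line B' l' \<and> on_line C' l' \<and> distinct [A', B', C'] \<and>
      common_point l l' \<notin> {A, B, C, A', B', C'} \<longrightarrow>
      collinear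
        {common_point (line_through A B') (line_through A' B),
         common_point (line_through A C') (line_through A' C),
         common_point (line_through B C') (line_through B' C)})"

end

locale space_of_incidence = incidence_structure on_line on_plane
  for on_line :: "'p \<Rightarrow> 'l \<Rightarrow> bool"
    and on_plane :: "'p \<Rightarrow> 'q \<Rightarrow> bool" +
  assumes S1: "P \<noteq> Q \<Longrightarrow> \<exists>!l. on_line P l \<and> on_line Q l"
    and S2: "\<alpha> \<noteq> \<beta> \<Longrightarrow> \<exists>!l. line_on_plane l \<alpha> \<and> line_on_plane l \<beta>"
    and S3: "distinct [P, Q, R] \<Longrightarrow> \<not> collinear {P, Q, R} \<Longrightarrow>
      \<exists>!\<pi>. on_plane P \<pi> \<and> on_plane Q \<pi> \<and> on_plane R \<pi>"
    and S4: "distinct [\<alpha>, \<beta>, \<gamma>] \<Longrightarrow>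
      \<not> (\<exists>l. line_on_plane l \<alpha> \<and> line_on_plane l \<beta> \<and> line_on_plane l \<gamma>) \<Longrightarrow>
      \<exists>!P. on_plane P \<alpha> \<and> on_plane P \<beta> \<and> on_plane P \<gamma>"
    and S5: "P \<noteq> Q \<Longrightarrow> on_line P l \<Longrightarrow> on_line Q l \<Longrightarrow>
      on_plane P \<pi> \<Longrightarrow> on_plane Q \<pi> \<Longrightarrow> on_line R l \<Longrightarrow> on_plane R \<pi>"
    and S6: "\<alpha> \<noteq> \<beta> \<Longrightarrow> line_on_plane l \<alpha> \<Longrightarrow> line_on_plane l \<beta> \<Longrightarrow>
      on_plane P \<alpha> \<Longrightarrow> on_plane P \<beta> \<Longrightarrow> line_on_plane l \<gamma> \<Longrightarrow> on_plane P \<gamma>"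
    and S7: "\<exists>S. card S = 4 \<and> (\<forall>P\<in>S. on_plane P \<pi>) \<and>
      (\<forall>T\<subseteq>S. card T = 3 \<longrightarrow> \<not> collinear T)"
    and S8: "\<exists>S. card S = 5 \<and> (\<forall>T\<subseteq>S. card T = 4 \<longrightarrow> \<not> coplanar T)"

end

(* Both directions use one figure.  Let l and l' be lines of a plane \<pi>, with
   A, B, C on l and A', B', C' on l', and let a, b, c pass through A, B, C and e, f, g
   through A', B', C', outside \<pi>, where a and b both meet e, f, g and c meets e, f.
   Put P = a \<inter> e and Q = b \<inter> f.  The planes af and be share P, Q and
   X = AB' \<inter> A'B; the planes ag and ce share P and Y = AC' \<inter> A'C; the planes bg
   and cf share Q and Z = BC' \<inter> B'C.

   Gallucci's axiom makes c and g meet in a point R.  Then Y lies on PR, Z on QR and X on PQ,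
   so X, Y, Z lie on the intersection of \<pi> with a plane through P, Q, R.

   Conversely, Pappus's theorem puts X, Y, Z in a plane with P, and hence with Q; there the lines
   PY and QZ meet, in a point of ag, ce, bg and cf, which is therefore on c and on g. *)

theory Submission
  imports Defs
begin

context space_of_incidence
begin

section \<open>Joining points, lines and planes\<close>

lemma line_unique:
  "P \<noteq> Q \<Longrightarrow> on_line P l \<Longrightarrow> on_line Q l \<Longrightarrow> on_line P m \<Longrightarrow> on_line Q m \<Longrightarrow> l = m"
  using S1 by blast

lemma line_on_planeI:
  "P \<noteq> Q \<Longrightarrow> on_line P l \<Longrightarrow> on_line Q l \<Longrightarrow> on_plane P \<pi> \<Longrightarrow> on_plane Q \<pi> \<Longrightarrow> line_on_plane l \<pi>"
  unfolding line_on_plane_def using S5 by blast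

lemma line_on_planeD: "line_on_plane l \<pi> \<Longrightarrow> on_line P l \<Longrightarrow> on_plane P \<pi>"
  by (simp add: line_on_plane_def)

lemma point_off_line: "\<exists>R. \<not> on_line R l"
proof (rule ccontr)
  assume all: "\<not> ?thesis"
  obtain S where S: "card S = 4" "\<And>T. T \<subseteq> S \<Longrightarrow> card T = 3 \<Longrightarrow> \<not> collinear T"
    using S7 by metis
  obtain T where "T \<subseteq> S" "card T = 3"
    using obtain_subset_with_card_n[of 3 S] S(1) by auto
  then show False using S(2) all unfolding collinear_def by blast
qed

lemma point_off_plane: "\<exists>R. \<not> on_plane R \<pi>"
proof (rule ccontr)
  assume all: "\<not> ?thesis"
  obtain S where S: "card S = 5" "\<And>T. T \<subseteq> S \<Longrightarrow> card T = 4 \<Longrightarrow> \<not> coplanar T"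
    using S8 by metis
  obtain T where "T \<subseteq> S" "card T = 4"
    using obtain_subset_with_card_n[of 4 S] S(1) by auto
  then show False using S(2) all unfolding coplanar_def by blast
qed

lemma other_point:
  fixes P :: 'p
  shows "\<exists>Q. Q \<noteq> P"
proof -
  obtain S :: "'p set" where "card S = 5" using S8 by blast
  then have "\<not> S \<subseteq> {P}" using card_mono[of "{P}" S] by auto
  then show ?thesis by blast
qed

lemma plane_through_noncollinear:
  assumes "P \<noteq> Q" "on_line P l" "on_line Q l" "\<not> on_line R l"
  shows "\<exists>!\<pi>. on_plane P \<pi> \<and> on_plane Q \<pi> \<and> on_plane R \<pi>"
proof -
  have "\<not> collinear {P, Q, R}"
    unfolding collinear_def using assms line_unique by blast
  then show ?thesis using assms by (intro S3) auto
qed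

lemma plane_through_two_points:
  assumes "P \<noteq> Q"
  shows "\<exists>\<pi>. on_plane P \<pi> \<and> on_plane Q \<pi> \<and> on_plane R \<pi>"
proof -
  obtain l where l: "on_line P l" "on_line Q l" using S1[OF assms] by blast
  show ?thesis
  proof (cases "on_line R l")
    case True
    obtain W where "\<not> on_line W l" using point_off_line by blast
    then obtain \<pi> where "on_plane P \<pi>" "on_plane Q \<pi>"
      using plane_through_noncollinear[OF assms l] by blast
    then show ?thesis using S5[OF assms l] True by blast
  next
    case False
    then show ?thesis using plane_through_noncollinear[OF assms l] by blast
  qed
qed

text \<open>When \<open>P\<close> and \<open>Q\<close> coincide, a different point takes the place
  of \<open>Q\<close>. No case distinction on the position of the three points is needed
  later.\<close>

lemma plane_through: "\<exists>\<pi>. on_plane P \<pi> \<and> on_plane Q \<pi> \<and> on_plane R \<pi>"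
  using plane_through_two_points other_point by metis

text \<open>No axiom says directly that a line has two points. A line with at most one point
  \<open>P\<close> would lie in every plane through \<open>P\<close>. Two such planes sharing a
  second point \<open>Q\<close> also have the line \<open>PQ\<close> in common, so S2 identifies the
  two lines.\<close>

lemma line_two_points: "\<exists>P Q. P \<noteq> Q \<and> on_line P l \<and> on_line Q l"
proof (rule ccontr)
  assume none: "\<not> ?thesis"
  \<comment> \<open>For a line without points, \<open>P\<close> is arbitrary.\<close>
  then obtain P where P: "\<And>X. on_line X l \<Longrightarrow> X = P" by blast
  obtain Q where "Q \<noteq> P" using other_point by blast
  then obtain m where PQ: "P \<noteq> Q" and m: "on_line P m" "on_line Q m" using S1 by metis
  obtain \<alpha> where \<alpha>: "on_plane P \<alpha>" "on_plane Q \<alpha>" using plane_through by blast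
  obtain V where V: "\<not> on_plane V \<alpha>" using point_off_plane by blast
  obtain \<beta> where \<beta>: "on_plane P \<beta>" "on_plane Q \<beta>" "on_plane V \<beta>" using plane_through by blast
  have "line_on_plane m \<alpha>" "line_on_plane m \<beta>" using line_on_planeI PQ m \<alpha> \<beta> by blast+
  moreover have "line_on_plane l \<alpha>" "line_on_plane l \<beta>"
    unfolding line_on_plane_def using P \<alpha>(1) \<beta>(1) by blast+
  moreover have "\<alpha> \<noteq> \<beta>" using V \<beta>(3) by blast
  ultimately have "l = m" using S2 by blast
  then show False using none PQ m by blast
qed

lemma line_other_point: "\<exists>Q. Q \<noteq> P \<and> on_line Q l"
  using line_two_points by metis

lemma plane_through_line: "\<exists>\<pi>. line_on_plane l \<pi> \<and> on_plane R \<pi>"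
  using line_two_points[of l] plane_through line_on_planeI by metis

lemma plane_unique:
  assumes "line_on_plane l \<alpha>" "line_on_plane l \<beta>" "on_plane R \<alpha>" "on_plane R \<beta>" "\<not> on_line R l"
  shows "\<alpha> = \<beta>"
proof -
  obtain P Q where PQ: "P \<noteq> Q" "on_line P l" "on_line Q l" using line_two_points by blast
  have "on_plane P \<alpha>" "on_plane Q \<alpha>" "on_plane P \<beta>" "on_plane Q \<beta>"
    using PQ assms line_on_planeD by blast+
  then show ?thesis using plane_through_noncollinear[OF PQ assms(5)] assms by blast
qed

lemma on_common_line:
  "\<alpha> \<noteq> \<beta> \<Longrightarrow> line_on_plane l \<alpha> \<Longrightarrow> line_on_plane l \<beta> \<Longrightarrow> on_plane X \<alpha> \<Longrightarrow> on_plane X \<beta> \<Longrightarrow> on_line X l"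
  using plane_unique by blast

text \<open>This is S6 with the axis given by two points: \<open>X\<close> lies in two planes of the
  pencil with axis \<open>PQ\<close>, hence in every plane of it.\<close>

lemma on_plane_pencil:
  assumes "\<alpha> \<noteq> \<beta>" "P \<noteq> Q" "on_plane P \<alpha>" "on_plane P \<beta>" "on_plane Q \<alpha>" "on_plane Q \<beta>"
    and "on_plane X \<alpha>" "on_plane X \<beta>" "on_plane P \<gamma>" "on_plane Q \<gamma>"
  shows "on_plane X \<gamma>"
proof -
  obtain m where "on_line P m" "on_line Q m" using S1[OF assms(2)] by blast
  then have "line_on_plane m \<alpha>" "line_on_plane m \<beta>" "line_on_plane m \<gamma>"
    using line_on_planeI assms by blast+
  then show ?thesis using S6 assms by blast
qed

lemma point_on_plane_unique:
  "\<not> line_on_plane a \<pi> \<Longrightarrow> on_line A a \<Longrightarrow> on_plane A \<pi> \<Longrightarrow> on_line P a \<Longrightarrow> on_plane P \<pi> \<Longrightarrow> P = A"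
  using line_on_planeI by blast

section \<open>Meeting lines, skew lines and transversals\<close>

text \<open>Two different lines are joined to a point \<open>V\<close> off \<pi>. A line common to
  \<pi> and the two joining planes would equal both \<open>l\<close> and \<open>m\<close>, so S4
  gives a common point of the three planes, and it lies on both lines.\<close>

lemma coplanar_lines_meet:
  assumes l: "line_on_plane l \<pi>" and m: "line_on_plane m \<pi>"
  shows "meets l m"
proof (cases "l = m")
  case True
  then show ?thesis unfolding meets_def using line_two_points by blast
next
  case False
  obtain V where V: "\<not> on_plane V \<pi>" using point_off_plane by blast
  obtain \<alpha> where \<alpha>: "line_on_plane l \<alpha>" "on_plane V \<alpha>" using plane_through_line by blast
  obtain \<beta> where \<beta>: "line_on_plane m \<beta>" "on_plane V \<beta>" using plane_through_line by blast
  have ne: "\<alpha> \<noteq> \<pi>" "\<beta> \<noteq> \<pi>" using V \<alpha> \<beta> by blast+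
  have l_only: "k = l" if "line_on_plane k \<alpha>" "line_on_plane k \<pi>" for k
    using S2[OF ne(1)] \<alpha> l that by blast
  have m_only: "k = m" if "line_on_plane k \<beta>" "line_on_plane k \<pi>" for k
    using S2[OF ne(2)] \<beta> m that by blast
  have "\<alpha> \<noteq> \<beta>" using l_only \<beta> m False by blast
  then obtain P where "on_plane P \<alpha>" "on_plane P \<beta>" "on_plane P \<pi>"
    using S4[of \<alpha> \<beta> \<pi>] ne l_only m_only False by auto
  then have "on_line P l" "on_line P m"
    using on_common_line[OF ne(1)] on_common_line[OF ne(2)] \<alpha> \<beta> l m by blast+
  then show ?thesis unfolding meets_def by blast
qed

lemma meeting_lines_coplanar:
  assumes "meets l m"
  shows "\<exists>\<pi>. line_on_plane l \<pi> \<and> line_on_plane m \<pi>"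
proof -
  obtain X where X: "on_line X l" "on_line X m" using assms unfolding meets_def by blast
  obtain Y Z where "Y \<noteq> X" "on_line Y l" "Z \<noteq> X" "on_line Z m" using line_other_point by metis
  then show ?thesis using plane_through[of X Y Z] line_on_planeI X by metis
qed

text \<open>Since a line meets itself, the inequality in \<open>skew\<close> is covered as well. The
  remaining arguments work with \<open>\<not> meets\<close> only.\<close>

lemma skew_iff: "skew l m \<longleftrightarrow> \<not> meets l m"
proof -
  have "meets l l" using plane_through_line coplanar_lines_meet by blast
  then show ?thesis
    unfolding skew_def using coplanar_lines_meet meeting_lines_coplanar by blast
qed

lemma meets_commute: "meets l m \<longleftrightarrow> meets m l"
  unfolding meets_def by blast

lemma meetsI: "on_line P l \<Longrightarrow> on_line P m \<Longrightarrow> meets l m"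
  unfolding meets_def by blast

text \<open>The transversal is the intersection of the planes joining \<open>P\<close> to
  \<open>e\<close> and to \<open>f\<close>; these differ because \<open>e\<close> and
  \<open>f\<close> are not coplanar.\<close>

lemma transversal_through:
  assumes "\<not> meets e f"
  shows "\<exists>t. on_line P t \<and> meets t e \<and> meets t f"
proof -
  obtain \<gamma> where \<gamma>: "line_on_plane e \<gamma>" "on_plane P \<gamma>" using plane_through_line by blast
  obtain \<delta> where \<delta>: "line_on_plane f \<delta>" "on_plane P \<delta>" using plane_through_line by blast
  have ne: "\<gamma> \<noteq> \<delta>" using assms coplanar_lines_meet \<gamma> \<delta> by blast
  then obtain t where t: "line_on_plane t \<gamma>" "line_on_plane t \<delta>" using S2 by blast
  then have "on_line P t" using on_common_line ne \<gamma> \<delta> by blast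
  then show ?thesis using coplanar_lines_meet t \<gamma> \<delta> by blast
qed

text \<open>If \<open>e\<close> and \<open>f\<close> met in \<open>X\<close>, each of
  \<open>a\<close>, \<open>b\<close>, \<open>c\<close> not through \<open>X\<close> would meet them
  in two different points and so lie in their plane. At most one of the three disjoint lines passes
  through \<open>X\<close>, so two of them would be coplanar and meet.\<close>

lemma distinct_transversals_disjoint:
  assumes abc: "\<not> meets a b" "\<not> meets a c" "\<not> meets b c"
    and e: "meets a e" "meets b e" "meets c e"
    and f: "meets a f" "meets b f" "meets c f"
    and "e \<noteq> f"
  shows "\<not> meets e f"
proof
  assume "meets e f"
  then obtain X \<pi> where X: "on_line X e" "on_line X f"
    and \<pi>: "line_on_plane e \<pi>" "line_on_plane f \<pi>"
    using meeting_lines_coplanar unfolding meets_def by blast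
  have on_\<pi>: "line_on_plane k \<pi>" if k: "meets k e" "meets k f" "\<not> on_line X k" for k
  proof -
    obtain Y Z where YZ: "on_line Y k" "on_line Y e" "on_line Z k" "on_line Z f"
      using k unfolding meets_def by blast
    have "Y \<noteq> Z" using YZ X k(3) \<open>e \<noteq> f\<close> line_unique by metis
    then show ?thesis using line_on_planeI YZ \<pi> line_on_planeD by metis
  qed
  have "\<not> (on_line X a \<and> on_line X b)" "\<not> (on_line X a \<and> on_line X c)"
    "\<not> (on_line X b \<and> on_line X c)"
    using abc meetsI by blast+
  then show False using on_\<pi> e f abc coplanar_lines_meet by metis
qed

section \<open>Named joins and crossings, and a point off two planes\<close>

lemma line_through_on:
  assumes "P \<noteq> Q"
  shows "on_line P (line_through P Q)" "on_line Q (line_through P Q)"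
  using theI'[OF S1[OF assms]] unfolding line_through_def by blast+

lemma common_point_eq:
  assumes "l \<noteq> m" "on_line X l" "on_line X m"
  shows "common_point l m = X"
  unfolding common_point_def using assms line_unique by (intro the_equality) blast+

text \<open>\<open>T\<close> is the crossing of \<open>P1P3\<close> and \<open>P2P4\<close>. The
  first line has only \<open>P1\<close> in \<alpha> and the second only \<open>P2\<close>, so
  \<open>T\<close> in \<alpha> would give \<open>P1 = P2\<close>; in the same way, \<open>T\<close>
  in \<beta> would give \<open>P3 = P4\<close>.\<close>

lemma point_off_crossing_lines:
  assumes "on_plane P1 \<rho>" "on_plane P2 \<rho>" "on_plane P3 \<rho>" "on_plane P4 \<rho>"
    and "P1 \<noteq> P2" "P3 \<noteq> P4"
    and "on_plane P1 \<alpha>" "on_plane P2 \<alpha>" "\<not> on_plane P3 \<alpha>" "\<not> on_plane P4 \<alpha>"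
    and "\<not> on_plane P1 \<beta>" "\<not> on_plane P2 \<beta>" "on_plane P3 \<beta>" "on_plane P4 \<beta>"
  shows "\<exists>T. \<not> on_plane T \<alpha> \<and> \<not> on_plane T \<beta>"
proof -
  have "P1 \<noteq> P3" "P2 \<noteq> P4" using assms by blast+
  then obtain k m where k: "on_line P1 k" "on_line P3 k" and m: "on_line P2 m" "on_line P4 m"
    using S1 by metis
  have "line_on_plane k \<rho>" "line_on_plane m \<rho>"
    using line_on_planeI \<open>P1 \<noteq> P3\<close> \<open>P2 \<noteq> P4\<close> k m assms by blast+
  then obtain T where T: "on_line T k" "on_line T m"
    using coplanar_lines_meet unfolding meets_def by blast
  have "\<not> on_plane T \<alpha>" using T k m assms S5 by metis
  moreover have "\<not> on_plane T \<beta>" using T k m assms S5 by metis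
  ultimately show ?thesis by blast
qed

text \<open>In a plane \<rho> different from both, take the four points of S7. Each of \<alpha>,
  \<beta> contains at most two of them, so a covering by \<alpha> and \<beta> splits them two and
  two, and a crossing of their joins escapes both planes.\<close>

lemma point_off_two_planes: "\<exists>T. \<not> on_plane T \<alpha> \<and> \<not> on_plane T \<beta>"
proof (rule ccontr)
  assume cover: "\<not> ?thesis"
  obtain U V where U: "\<not> on_plane U \<alpha>" and V: "\<not> on_plane V \<beta>" using point_off_plane by metis
  obtain \<rho> where \<rho>: "on_plane U \<rho>" "on_plane V \<rho>" using plane_through by blast
  have ne: "\<rho> \<noteq> \<alpha>" "\<rho> \<noteq> \<beta>" using U V \<rho> by blast+
  obtain S where S: "card S = 4" "\<And>P. P \<in> S \<Longrightarrow> on_plane P \<rho>"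
    "\<And>T. T \<subseteq> S \<Longrightarrow> card T = 3 \<Longrightarrow> \<not> collinear T"
    using S7 by metis
  obtain P1 P2 P3 P4 where P: "S = {P1, P2, P3, P4}" "distinct [P1, P2, P3, P4]"
  proof -
    obtain xs where xs: "set xs = S" "distinct xs"
      using S(1) finite_distinct_list[of S] card.infinite[of S] by force
    then have "length xs = 4" using S(1) distinct_card by metis
    then obtain P1 P2 P3 P4 where "xs = [P1, P2, P3, P4]"
      by (auto simp: numeral_eq_Suc length_Suc_conv)
    then show ?thesis using that xs by auto
  qed
  \<comment> \<open>Three of the four points in another plane \<gamma> would all lie on the line
    common to \<gamma> and \<rho>.\<close>
  have no3: False if XYZ: "{X, Y, Z} \<subseteq> S" "distinct [X, Y, Z]" "\<gamma> \<noteq> \<rho>"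
    "on_plane X \<gamma>" "on_plane Y \<gamma>" "on_plane Z \<gamma>" for X Y Z \<gamma>
  proof -
    obtain k where k: "line_on_plane k \<gamma>" "line_on_plane k \<rho>" using S2[OF XYZ(3)] by blast
    then have "collinear {X, Y, Z}"
      unfolding collinear_def using on_common_line[OF XYZ(3) k] XYZ S(2) by blast
    then show False using S(3)[OF XYZ(1)] XYZ(2) by auto
  qed
  have triples: "\<not> (on_plane P1 \<gamma> \<and> on_plane P2 \<gamma> \<and> on_plane P3 \<gamma>)"
    "\<not> (on_plane P1 \<gamma> \<and> on_plane P2 \<gamma> \<and> on_plane P4 \<gamma>)"
    "\<not> (on_plane P1 \<gamma> \<and> on_plane P3 \<gamma> \<and> on_plane P4 \<gamma>)"
    "\<not> (on_plane P2 \<gamma> \<and> on_plane P3 \<gamma> \<and> on_plane P4 \<gamma>)" if "\<gamma> \<noteq> \<rho>" for \<gamma>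
    using no3[of P1 P2 P3 \<gamma>] no3[of P1 P2 P4 \<gamma>] no3[of P1 P3 P4 \<gamma>] no3[of P2 P3 P4 \<gamma>] P that
    by auto
  have two_two: False if "{X, Y, Z, W} \<subseteq> S" "distinct [X, Y, Z, W]"
    "on_plane X \<alpha>" "on_plane Y \<alpha>" "\<not> on_plane Z \<alpha>" "\<not> on_plane W \<alpha>"
    "\<not> on_plane X \<beta>" "\<not> on_plane Y \<beta>" "on_plane Z \<beta>" "on_plane W \<beta>" for X Y Z W
    using point_off_crossing_lines[of X \<rho> Y Z W \<alpha> \<beta>] that S(2) cover by auto
  note pairs = two_two[of P1 P2 P3 P4] two_two[of P1 P3 P2 P4] two_two[of P1 P4 P2 P3]
    two_two[of P2 P3 P1 P4] two_two[of P2 P4 P1 P3] two_two[of P3 P4 P1 P2]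
  have covered: "on_plane X \<alpha> \<or> on_plane X \<beta>" for X using cover by blast
  show False
    using triples[OF ne(1)[symmetric]] triples[OF ne(2)[symmetric]] pairs[unfolded P(1)] P(2)
      covered[of P1] covered[of P2] covered[of P3] covered[of P4]
    by simp metis
qed

section \<open>The crossings in the Pappus figure\<close>

text \<open>The plane \<alpha> contains the line \<open>AB'\<close> and \<beta> contains
  \<open>A'B\<close>, so the crossing is in both. The statement treats one pair of indices; renaming
  gives all three Pappus points.\<close>

lemma cross_point:
  assumes \<pi>: "line_on_plane l \<pi>" "line_on_plane l' \<pi>"
    and l: "on_line A l" "on_line B l" "A \<noteq> B" "\<not> on_line A l'" "\<not> on_line B l'"
    and l': "on_line A' l'" "on_line B' l'" "A' \<noteq> B'" "\<not> on_line A' l" "\<not> on_line B' l"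
    and lines: "on_line A a" "on_line B b" "on_line A' e" "on_line B' f" "\<not> line_on_plane a \<pi>"
    and \<alpha>: "line_on_plane a \<alpha>" "line_on_plane f \<alpha>"
    and \<beta>: "line_on_plane b \<beta>" "line_on_plane e \<beta>"
    and X_def: "X = common_point (line_through A B') (line_through A' B)"
  shows "\<alpha> \<noteq> \<beta>" "on_plane X \<pi>" "on_plane X \<alpha>" "on_plane X \<beta>"
proof -
  have pts: "on_plane A \<pi>" "on_plane B \<pi>" "on_plane A' \<pi>" "on_plane B' \<pi>"
    "on_plane A \<alpha>" "on_plane B' \<alpha>" "on_plane B \<beta>" "on_plane A' \<beta>"
    using \<pi> l l' lines \<alpha> \<beta> line_on_planeD by blast+
  show "\<alpha> \<noteq> \<beta>"
  proof
    \<comment> \<open>The common plane would contain \<open>l\<close> and \<open>B'\<close>, hence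
      be \<pi>, although \<open>a\<close> is not in \<pi>.\<close>
    assume "\<alpha> = \<beta>"
    then have "line_on_plane l \<alpha>" using line_on_planeI l pts by blast
    then have "\<alpha> = \<pi>" using plane_unique \<pi>(1) pts(6) pts(4) l'(5) by blast
    then show False using lines(5) \<alpha>(1) by blast
  qed
  define m where "m = line_through A B'"
  define n where "n = line_through A' B"
  have ne: "A \<noteq> B'" "A' \<noteq> B" using l l' by blast+
  have m: "on_line A m" "on_line B' m" unfolding m_def using line_through_on ne by blast+
  have n: "on_line A' n" "on_line B n" unfolding n_def using line_through_on ne by blast+
  have "m \<noteq> n" using m n l l' line_unique by metis
  have on: "line_on_plane m \<pi>" "line_on_plane n \<pi>" "line_on_plane m \<alpha>" "line_on_plane n \<beta>"
    using line_on_planeI ne m n pts by blast+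
  then obtain X' where "on_line X' m" "on_line X' n"
    using coplanar_lines_meet unfolding meets_def by blast
  moreover from this have "X = X'"
    unfolding X_def m_def[symmetric] n_def[symmetric] using common_point_eq[OF \<open>m \<noteq> n\<close>] by blast
  ultimately show "on_plane X \<pi>" "on_plane X \<alpha>" "on_plane X \<beta>" using on line_on_planeD by blast+
qed

section \<open>From Pappus to Gallucci\<close>

text \<open>This is the nondegenerate case of Gallucci's axiom, with skew triples \<open>a\<close>,
  \<open>b\<close>, \<open>l'\<close> and \<open>e\<close>, \<open>f\<close>, \<open>l\<close> and
  further transversals \<open>g\<close> and \<open>c\<close>. The meeting lines \<open>l\<close> and
  \<open>l'\<close> carry the Pappus figure; \<open>new\<close> makes the three points on each of
  them distinct.\<close>

lemma pappus_imp_meets: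
  assumes pappus: pappus_theorem
    and skew1: "\<not> meets a b" "\<not> meets a l'" "\<not> meets b l'"
    and skew2: "\<not> meets e f" "\<not> meets e l" "\<not> meets f l"
    and nine: "meets a e" "meets a f" "meets a l" "meets b e" "meets b f" "meets b l"
      "meets l' e" "meets l' f" "meets l' l"
    and g: "meets a g" "meets b g" "meets l' g"
    and c: "meets c e" "meets c f" "meets c l"
    and new: "c \<notin> {a, b, l'}" "g \<notin> {e, f, l}"
  shows "meets c g"
proof -
  \<comment> \<open>\<open>c\<close> is a fourth transversal of \<open>e\<close>, \<open>f\<close>,
    \<open>l\<close> beside \<open>a\<close>, \<open>b\<close>, \<open>l'\<close>; the dual argument
    for \<open>g\<close> follows.\<close>
  have disj_c: "\<not> meets a c" "\<not> meets b c" "\<not> meets c l'"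
    using distinct_transversals_disjoint[OF skew2, of a c]
      distinct_transversals_disjoint[OF skew2, of b c]
      distinct_transversals_disjoint[OF skew2, of c l'] nine c new meets_commute by auto
  have disj_g: "\<not> meets e g" "\<not> meets f g" "\<not> meets g l"
    using distinct_transversals_disjoint[OF skew1, of e g]
      distinct_transversals_disjoint[OF skew1, of f g]
      distinct_transversals_disjoint[OF skew1, of g l] nine g new by auto
  obtain \<pi> where \<pi>: "line_on_plane l \<pi>" "line_on_plane l' \<pi>"
    using meeting_lines_coplanar nine(9) by blast
  obtain A B C where ABC: "on_line A a" "on_line A l" "on_line B b" "on_line B l"
    "on_line C c" "on_line C l"
    using nine c unfolding meets_def by metis
  obtain A' B' C' where ABC': "on_line A' e" "on_line A' l'" "on_line B' f" "on_line B' l'"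
    "on_line C' g" "on_line C' l'"
    using nine g unfolding meets_def by metis
  have off: "\<not> on_line A l'" "\<not> on_line B l'" "\<not> on_line C l'"
    "\<not> on_line A' l" "\<not> on_line B' l" "\<not> on_line C' l"
    using ABC ABC' skew1 skew2 disj_c disj_g meetsI by blast+
  have ne: "A \<noteq> B" "A \<noteq> C" "B \<noteq> C" "A' \<noteq> B'" "A' \<noteq> C'" "B' \<noteq> C'"
    using ABC ABC' skew1 skew2 disj_c disj_g meetsI by blast+
  have out: "\<not> line_on_plane a \<pi>" "\<not> line_on_plane b \<pi>" "\<not> line_on_plane e \<pi>" "\<not> line_on_plane f \<pi>"
    using \<pi> skew1 skew2 coplanar_lines_meet by blast+
  have "l \<noteq> l'" using ABC off by blast
  obtain O' where "on_line O' l" "on_line O' l'" using nine(9) unfolding meets_def by blast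
  then have "on_line (common_point l l') l" "on_line (common_point l l') l'"
    using common_point_eq[OF \<open>l \<noteq> l'\<close>] by auto
  then have O_notin: "common_point l l' \<notin> {A, B, C, A', B', C'}" using off by auto
  define X where "X = common_point (line_through A B') (line_through A' B)"
  define Y where "Y = common_point (line_through A C') (line_through A' C)"
  define Z where "Z = common_point (line_through B C') (line_through B' C)"
  have "collinear {X, Y, Z}"
    unfolding X_def Y_def Z_def
    by (rule pappus[unfolded pappus_theorem_def, rule_format, of l \<pi> l'])
      (use \<pi> \<open>l \<noteq> l'\<close> ABC ABC' ne O_notin in auto)
  then obtain p where p: "on_line X p" "on_line Y p" "on_line Z p"
    unfolding collinear_def by blast
  obtain \<alpha>1 \<beta>1 where 1: "line_on_plane a \<alpha>1" "line_on_plane f \<alpha>1"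
    "line_on_plane b \<beta>1" "line_on_plane e \<beta>1"
    using meeting_lines_coplanar nine by metis
  obtain \<alpha>2 \<beta>2 where 2: "line_on_plane a \<alpha>2" "line_on_plane g \<alpha>2"
    "line_on_plane c \<beta>2" "line_on_plane e \<beta>2"
    using meeting_lines_coplanar nine g c by metis
  obtain \<alpha>3 \<beta>3 where 3: "line_on_plane b \<alpha>3" "line_on_plane g \<alpha>3"
    "line_on_plane c \<beta>3" "line_on_plane f \<beta>3"
    using meeting_lines_coplanar nine g c by metis
  note X = cross_point[OF \<pi> ABC(2,4) ne(1) off(1,2) ABC'(2,4) ne(4) off(4,5)
      ABC(1,3) ABC'(1,3) out(1) 1 X_def]
  note Y = cross_point[OF \<pi> ABC(2,6) ne(2) off(1,3) ABC'(2,6) ne(5) off(4,6)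
      ABC(1,5) ABC'(1,5) out(1) 2 Y_def]
  note Z = cross_point[OF \<pi> ABC(4,6) ne(3) off(2,3) ABC'(4,6) ne(6) off(5,6)
      ABC(3,5) ABC'(3,5) out(2) 3 Z_def]
  obtain P Q where P: "on_line P a" "on_line P e" and Q: "on_line Q b" "on_line Q f"
    using nine unfolding meets_def by metis
  have in_\<pi>: "on_plane A \<pi>" "on_plane B \<pi>" "on_plane A' \<pi>" "on_plane B' \<pi>"
    using ABC ABC' \<pi> line_on_planeD by blast+
  \<comment> \<open>\<open>a\<close> and \<open>e\<close> meet \<pi> only in \<open>A\<close> and
    \<open>A'\<close>, so \<open>P\<close> in \<pi> would give \<open>A = A'\<close>.\<close>
  have P_out: "\<not> on_plane P \<pi>"
    using point_on_plane_unique[OF out(1) ABC(1) in_\<pi>(1) P(1)]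
      point_on_plane_unique[OF out(3) ABC'(1) in_\<pi>(3) P(2)] ABC(2) off(4) by blast
  have Q_out: "\<not> on_plane Q \<pi>"
    using point_on_plane_unique[OF out(2) ABC(3) in_\<pi>(2) Q(1)]
      point_on_plane_unique[OF out(4) ABC'(3) in_\<pi>(4) Q(2)] ABC(4) off(5) by blast
  have P_on: "on_plane P \<alpha>1" "on_plane P \<beta>1" "on_plane P \<alpha>2" "on_plane P \<beta>2"
    using P 1 2 line_on_planeD by blast+
  have Q_on: "on_plane Q \<alpha>1" "on_plane Q \<beta>1" "on_plane Q \<alpha>3" "on_plane Q \<beta>3"
    using Q 1 3 line_on_planeD by blast+
  obtain \<sigma> where \<sigma>: "line_on_plane p \<sigma>" "on_plane P \<sigma>" using plane_through_line by blast
  have XYZ_\<sigma>: "on_plane X \<sigma>" "on_plane Y \<sigma>" "on_plane Z \<sigma>" using p \<sigma> line_on_planeD by blast+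
  have "P \<noteq> X" "P \<noteq> Y" "Q \<noteq> Z" using P_out Q_out X Y Z by blast+
  \<comment> \<open>\<open>P\<close>, \<open>Q\<close>, \<open>X\<close> are common to
    \<open>\<alpha>1\<close> and \<open>\<beta>1\<close>, and \<sigma> contains \<open>P\<close> and
    \<open>X\<close>.\<close>
  have "on_plane Q \<sigma>"
    using on_plane_pencil[OF X(1) \<open>P \<noteq> X\<close>] P_on Q_on X \<sigma> XYZ_\<sigma> by blast
  obtain n k where n: "on_line P n" "on_line Y n" and k: "on_line Q k" "on_line Z k"
    using S1 \<open>P \<noteq> Y\<close> \<open>Q \<noteq> Z\<close> by metis
  have n_on: "line_on_plane n \<sigma>" "line_on_plane n \<alpha>2" "line_on_plane n \<beta>2"
    using line_on_planeI[OF \<open>P \<noteq> Y\<close> n] P_on Y \<sigma> XYZ_\<sigma> by blast+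
  have k_on: "line_on_plane k \<sigma>" "line_on_plane k \<alpha>3" "line_on_plane k \<beta>3"
    using line_on_planeI[OF \<open>Q \<noteq> Z\<close> k] Q_on Z \<open>on_plane Q \<sigma>\<close> XYZ_\<sigma> by blast+
  obtain W where "on_line W n" "on_line W k"
    using coplanar_lines_meet n_on(1) k_on(1) unfolding meets_def by blast
  then have W: "on_plane W \<alpha>2" "on_plane W \<beta>2" "on_plane W \<alpha>3" "on_plane W \<beta>3"
    using n_on k_on line_on_planeD by blast+
  \<comment> \<open>Equality would make \<open>a\<close> and \<open>b\<close> coplanar. Both planes
    contain \<open>g\<close>, so their common point \<open>W\<close> is on \<open>g\<close>;
    likewise \<open>\<beta>2\<close> and \<open>\<beta>3\<close> put it on \<open>c\<close>.\<close>
  have "\<alpha>2 \<noteq> \<alpha>3" using skew1(1) coplanar_lines_meet 2 3 by blast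
  then have "on_line W g" using on_common_line 2 3 W by blast
  moreover have "\<beta>2 \<noteq> \<beta>3" using skew2(1) coplanar_lines_meet 2 3 by blast
  then have "on_line W c" using on_common_line 2 3 W by blast
  ultimately show ?thesis using meetsI by blast
qed

lemma pappus_imp_gallucci:
  assumes pappus_theorem
  shows gallucci_axiom
  unfolding gallucci_axiom_def skew_iff
proof (intro allI impI, elim conjE)
  fix a b c e f g h d
  assume sk: "\<not> meets a b" "\<not> meets a c" "\<not> meets b c" "\<not> meets e f" "\<not> meets e g" "\<not> meets f g"
    and nine: "\<forall>x\<in>{a, b, c}. \<forall>y\<in>{e, f, g}. meets x y"
    and h: "\<forall>x\<in>{a, b, c}. meets h x" and d: "\<forall>y\<in>{e, f, g}. meets d y"
  show "meets h d"
  \<comment> \<open>A transversal that already belongs to the opposite triple meets the other one by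
    hypothesis.\<close>
  proof (cases "d \<in> {a, b, c} \<or> h \<in> {e, f, g}")
    case True
    then show ?thesis using h d meets_commute by blast
  next
    case False
    have "meets d h"
      by (rule pappus_imp_meets[OF assms sk]) (use nine h d meets_commute False in auto)
    then show ?thesis using meets_commute by blast
  qed
qed

section \<open>From Gallucci to Pappus\<close>

text \<open>The plane figure is completed to a spatial one: disjoint lines \<open>a\<close>,
  \<open>b\<close> leave \<pi> at \<open>A\<close>, \<open>B\<close>, then their transversals
  \<open>e\<close>, \<open>f\<close>, \<open>g\<close> are drawn through \<open>A'\<close>,
  \<open>B'\<close>, \<open>C'\<close>, and finally a transversal \<open>c\<close> of
  \<open>e\<close>, \<open>f\<close> through \<open>C\<close>.\<close>

lemma gallucci_imp_pappus:
  assumes gallucci: gallucci_axiom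
  shows pappus_theorem
  unfolding pappus_theorem_def
proof (intro allI impI, elim conjE)
  fix \<pi> l l' A B C A' B' C'
  assume \<pi>: "line_on_plane l \<pi>" "line_on_plane l' \<pi>" and "l \<noteq> l'"
    and ABC: "on_line A l" "on_line B l" "on_line C l"
    and ABC': "on_line A' l'" "on_line B' l'" "on_line C' l'"
    and dist: "distinct [A, B, C]" "distinct [A', B', C']"
    and O_notin: "common_point l l' \<notin> {A, B, C, A', B', C'}"
  define X where "X = common_point (line_through A B') (line_through A' B)"
  define Y where "Y = common_point (line_through A C') (line_through A' C)"
  define Z where "Z = common_point (line_through B C') (line_through B' C)"
  have ne: "A \<noteq> B" "A \<noteq> C" "B \<noteq> C" "A' \<noteq> B'" "A' \<noteq> C'" "B' \<noteq> C'" using dist by auto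
  have off: "\<not> on_line A l'" "\<not> on_line B l'" "\<not> on_line C l'"
    "\<not> on_line A' l" "\<not> on_line B' l" "\<not> on_line C' l"
    using common_point_eq[OF \<open>l \<noteq> l'\<close>] ABC ABC' O_notin by auto
  have ll': "meets l l'" using \<pi> coplanar_lines_meet by blast
  have in_\<pi>: "on_plane A \<pi>" "on_plane B \<pi>" "on_plane C \<pi>"
    "on_plane A' \<pi>" "on_plane B' \<pi>" "on_plane C' \<pi>"
    using ABC ABC' \<pi> line_on_planeD by blast+
  obtain V where V: "\<not> on_plane V \<pi>" using point_off_plane by blast
  obtain a where a: "on_line A a" "on_line V a" using S1 in_\<pi>(1) V by metis
  obtain \<alpha> where \<alpha>: "line_on_plane a \<alpha>" "on_plane B \<alpha>" using plane_through_line by blast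
  \<comment> \<open>A point off both planes makes \<open>b = BT\<close> leave \<pi> and meet the
    plane \<alpha> of \<open>a\<close> and \<open>B\<close> only in \<open>B\<close>. As
    \<open>B\<close> is not on \<open>a\<close>, the lines \<open>a\<close> and \<open>b\<close> are
    disjoint.\<close>
  obtain T where T: "\<not> on_plane T \<alpha>" "\<not> on_plane T \<pi>" using point_off_two_planes by blast
  obtain b where b: "on_line B b" "on_line T b" using S1 in_\<pi>(2) T by metis
  have a_out: "\<not> line_on_plane a \<pi>" and b_out: "\<not> line_on_plane b \<pi>"
    using a b V T line_on_planeD by blast+
  have "\<not> line_on_plane b \<alpha>" using b T line_on_planeD by blast
  have "\<not> on_line B a"
    using point_on_plane_unique[OF a_out a(1) in_\<pi>(1) _ in_\<pi>(2)] ne(1) by blast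
  have ab: "\<not> meets a b"
  proof
    assume "meets a b"
    then obtain R where R: "on_line R a" "on_line R b" unfolding meets_def by blast
    then have "R = B"
      using point_on_plane_unique[OF \<open>\<not> line_on_plane b \<alpha>\<close> b(1) \<alpha>(2)] \<alpha>(1) line_on_planeD by blast
    then show False using R \<open>\<not> on_line B a\<close> by blast
  qed
  have al': "\<not> meets a l'" and bl': "\<not> meets b l'"
    using point_on_plane_unique[OF a_out a(1) in_\<pi>(1)] point_on_plane_unique[OF b_out b(1) in_\<pi>(2)]
      off \<pi>(2) line_on_planeD unfolding meets_def by blast+
  have transversal: "\<exists>t. on_line D t \<and> meets a t \<and> meets b t \<and> \<not> line_on_plane t \<pi>"
    if D: "on_plane D \<pi>" "\<not> on_line D l" for D
  proof -
    obtain t where t: "on_line D t" "meets t a" "meets t b" using transversal_through ab by blast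
    \<comment> \<open>Inside \<pi>, \<open>t\<close> could meet \<open>a\<close> and
      \<open>b\<close> only in \<open>A\<close> and \<open>B\<close>, so it would be
      \<open>l\<close>, which misses \<open>D\<close>.\<close>
    have "\<not> line_on_plane t \<pi>"
    proof
      assume "line_on_plane t \<pi>"
      then have "on_line A t" "on_line B t"
        using point_on_plane_unique[OF a_out a(1) in_\<pi>(1)]
          point_on_plane_unique[OF b_out b(1) in_\<pi>(2)] t line_on_planeD
        unfolding meets_def by blast+
      then show False using line_unique[OF ne(1)] ABC t(1) D(2) by blast
    qed
    then show ?thesis using t meets_commute by blast
  qed
  obtain e where e: "on_line A' e" "meets a e" "meets b e" "\<not> line_on_plane e \<pi>"
    using transversal in_\<pi>(4) off(4) by blast
  obtain f where f: "on_line B' f" "meets a f" "meets b f" "\<not> line_on_plane f \<pi>"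
    using transversal in_\<pi>(5) off(5) by blast
  obtain g where g: "on_line C' g" "meets a g" "meets b g" "\<not> line_on_plane g \<pi>"
    using transversal in_\<pi>(6) off(6) by blast
  have "e \<noteq> f" "e \<noteq> g" "f \<noteq> g" "e \<noteq> l" "f \<noteq> l"
    using point_on_plane_unique[OF e(4,1) in_\<pi>(4)] point_on_plane_unique[OF f(4,1) in_\<pi>(5)]
      e f g in_\<pi> ne \<pi>(1) by metis+
  moreover have l'_meets: "meets l' e" "meets l' f" "meets l' g"
    using meetsI ABC' e f g by blast+
  moreover have l_meets: "meets a l" "meets b l" "meets l' l"
    using meetsI ABC a b ll' meets_commute by blast+
  ultimately have sk: "\<not> meets e f" "\<not> meets e g" "\<not> meets f g" "\<not> meets e l" "\<not> meets f l"
    using distinct_transversals_disjoint[OF ab al' bl'] e f g by blast+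
  obtain c where c: "on_line C c" "meets c e" "meets c f" using transversal_through sk(1) by blast
  \<comment> \<open>The skew triples are \<open>a\<close>, \<open>b\<close>, \<open>l'\<close> and
    \<open>e\<close>, \<open>f\<close>, \<open>l\<close>; \<open>g\<close> meets the first triple
    and \<open>c\<close> the second.\<close>
  have "meets g c"
  proof (rule gallucci[unfolded gallucci_axiom_def skew_iff, rule_format])
    show "\<not> meets a b \<and> \<not> meets a l' \<and> \<not> meets b l' \<and> \<not> meets e f \<and> \<not> meets e l \<and> \<not> meets f l \<and>
      (\<forall>x\<in>{a, b, l'}. \<forall>y\<in>{e, f, l}. meets x y)"
      using ab al' bl' sk e f l'_meets l_meets by auto
    show "(\<forall>x\<in>{a, b, l'}. meets g x) \<and> (\<forall>y\<in>{e, f, l}. meets c y)"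
      using g c l'_meets meetsI ABC(3) meets_commute by auto
  qed
  then obtain R where R: "on_line R c" "on_line R g" unfolding meets_def by blast
  obtain \<alpha>1 \<beta>1 where 1: "line_on_plane a \<alpha>1" "line_on_plane f \<alpha>1"
    "line_on_plane b \<beta>1" "line_on_plane e \<beta>1"
    using meeting_lines_coplanar e f by metis
  obtain \<alpha>2 \<beta>2 where 2: "line_on_plane a \<alpha>2" "line_on_plane g \<alpha>2"
    "line_on_plane c \<beta>2" "line_on_plane e \<beta>2"
    using meeting_lines_coplanar g c by metis
  obtain \<alpha>3 \<beta>3 where 3: "line_on_plane b \<alpha>3" "line_on_plane g \<alpha>3"
    "line_on_plane c \<beta>3" "line_on_plane f \<beta>3"
    using meeting_lines_coplanar g c by metis
  note X = cross_point[OF \<pi> ABC(1,2) ne(1) off(1,2) ABC'(1,2) ne(4) off(4,5)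
      a(1) b(1) e(1) f(1) a_out 1 X_def]
  note Y = cross_point[OF \<pi> ABC(1,3) ne(2) off(1,3) ABC'(1,3) ne(5) off(4,6)
      a(1) c(1) e(1) g(1) a_out 2 Y_def]
  note Z = cross_point[OF \<pi> ABC(2,3) ne(3) off(2,3) ABC'(2,3) ne(6) off(5,6)
      b(1) c(1) f(1) g(1) b_out 3 Z_def]
  obtain P Q where P: "on_line P a" "on_line P e" and Q: "on_line Q b" "on_line Q f"
    using e f unfolding meets_def by metis
  have "P \<noteq> Q" "P \<noteq> R" "Q \<noteq> R" using P Q R ab sk meetsI by blast+
  obtain \<sigma> where \<sigma>: "on_plane P \<sigma>" "on_plane Q \<sigma>" "on_plane R \<sigma>" using plane_through by blast
  \<comment> \<open>The pairs of planes that define \<open>X\<close>, \<open>Y\<close>,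
    \<open>Z\<close> have the axes \<open>PQ\<close>, \<open>PR\<close>, \<open>QR\<close>, and
    \<sigma> contains all three axes.\<close>
  have "on_plane X \<sigma>"
    using on_plane_pencil[OF X(1) \<open>P \<noteq> Q\<close>] P Q X 1 \<sigma> line_on_planeD by blast
  moreover have "on_plane Y \<sigma>"
    using on_plane_pencil[OF Y(1) \<open>P \<noteq> R\<close>] P R Y 2 \<sigma> line_on_planeD by blast
  moreover have "on_plane Z \<sigma>"
    using on_plane_pencil[OF Z(1) \<open>Q \<noteq> R\<close>] Q R Z 3 \<sigma> line_on_planeD by blast
  \<comment> \<open>\<open>P\<close> is not in \<pi>, since otherwise it would be both
    \<open>A\<close> and \<open>A'\<close>.\<close>
  moreover have "\<sigma> \<noteq> \<pi>"
    using point_on_plane_unique[OF a_out a(1) in_\<pi>(1) P(1)]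
      point_on_plane_unique[OF e(4,1) in_\<pi>(4) P(2)] ABC(1) off(4) \<sigma>(1) by blast
  moreover from this obtain k where "line_on_plane k \<sigma>" "line_on_plane k \<pi>" using S2 by blast
  ultimately have "collinear {X, Y, Z}"
    unfolding collinear_def using on_common_line X(2) Y(2) Z(2) by blast
  then show "collinear
        {common_point (line_through A B') (line_through A' B),
         common_point (line_through A C') (line_through A' C),
         common_point (line_through B C') (line_through B' C)}"
    unfolding X_def Y_def Z_def .
qed

end

theorem mainTheorem2:
  fixes on_line :: "'p \<Rightarrow> 'l \<Rightarrow> bool"
    and on_plane :: "'p \<Rightarrow> 'q \<Rightarrow> bool"
  assumes "space_of_incidence on_line on_plane"
  shows "incidence_structure.gallucci_axiom on_line on_plane \<longleftrightarrow>
    incidence_structure.pappus_theorem on_line on_plane"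
proof -
  interpret space_of_incidence on_line on_plane by fact
  show ?thesis using gallucci_imp_pappus pappus_imp_gallucci by blast
qed

end
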